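(* Consider the stripe-game. The value of the game on a $2\times m$ grid is $\lceil m/2\rceil$ if Maximizer responds (and Minimizer initiates), and $\lfloor m/2\rfloor$ if Minimizer responds (and Maximizer initiates).
   Context: $P_3$ is the path on three vertices; copies of $P_3$ in a graph are subgraphs, not necessarily induced. The $2\times m$ grid is the Cartesian product of the path on $2$ vertices and the path on $m$ vertices ($2$ rows and $m$ columns, with vertices adjacent when they are horizontally or vertically consecutive). The stripe-game on a graph $G$ is played by two players, Maximizer and Minimizer; throughout the game one of them is the initiator and the other is the responder. In each round, the initiator chooses a vertex $v$ of the current graph such that the current graph contains at least one copy of $P_3$ with $v$ as an end-vertex; the responder then chooses one copy of $P_3$ in the current graph with $v$ as an end-vertex; the three vertices of that copy are removed, and the next round is played on the subgraph induced by the remaining vertices. The game ends when the remaining graph contains no copy of $P_3$. Maximizer tries to maximize, and Minimizer tries to minimize, the number of copies of $P_3$ taken. The value of the game is the number of copies taken under optimal play by both players.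
   Formalization: The value ⌈m/2⌉ when Maximizer responds is stated only for m ≥ 2: for m = 1 the grid is a single edge with no copy of P_3, so the value is 0 rather than ⌈1/2⌉ = 1; the value ⌊m/2⌋ when Minimizer responds is stated for all m ≥ 1. *)

theory Defs
  imports Complex_Main
begin

datatype 'a graph = Graph (verts: "'a set") (edges: "'a set set")

definition subgraph :: "'a graph \<Rightarrow> 'a graph \<Rightarrow> bool" where
  "subgraph H G \<longleftrightarrow> verts H \<subseteq> verts G \<and> edges H \<subseteq> edges G"

definition induced_subgraph :: "'a graph \<Rightarrow> 'a set \<Rightarrow> 'a graph" where
  "induced_subgraph G S = Graph (verts G \<inter> S) {e \<in> edges G. e \<subseteq> S}"

definition path_graph :: "nat \<Rightarrow> nat graph" where
  "path_graph n = Graph {..<n} {{i, Suc i} | i. Suc i < n}"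

definition cartesian_product :: "'a graph \<Rightarrow> 'b graph \<Rightarrow> ('a \<times> 'b) graph" where
  "cartesian_product G H = Graph (verts G \<times> verts H)
     ({{(x, y), (x', y)} | x x' y. {x, x'} \<in> edges G \<and> y \<in> verts H} \<union>
      {{(x, y), (x, y')} | x y y'. x \<in> verts G \<and> {y, y'} \<in> edges H})"

definition grid :: "nat \<Rightarrow> nat \<Rightarrow> (nat \<times> nat) graph" where
  "grid k m = cartesian_product (path_graph k) (path_graph m)"

text \<open>The copies of the three-vertex path in \<open>G\<close> (as subgraphs, not necessarily induced) that have
  \<open>v\<close> as an end-vertex; the middle vertex is \<open>a\<close>.\<close>

definition P3_copies :: "'a graph \<Rightarrow> 'a \<Rightarrow> 'a graph set" where
  "P3_copies G v =
     {C. subgraph C G \<and> (\<exists>a b. distinct [v, a, b] \<and> C = Graph {v, a, b} {{v, a}, {a, b}})}"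

definition end_vertices :: "'a graph \<Rightarrow> 'a set" where
  "end_vertices G = {v \<in> verts G. P3_copies G v \<noteq> {}}"

datatype player = Maximizer | Minimizer

fun opponent :: "player \<Rightarrow> player" where
  "opponent Maximizer = Minimizer"
| "opponent Minimizer = Maximizer"

fun best :: "player \<Rightarrow> nat set \<Rightarrow> nat" where
  "best Maximizer A = Max A"
| "best Minimizer A = Min A"

text \<open>The number of copies taken under optimal play from position \<open>G\<close>, by backward induction;
  \<open>p\<close> is the initiator in all rounds, and \<open>opponent p\<close> is the responder.  The value \<open>0\<close> for
  infinite graphs is a dummy.\<close>

function stripe_value :: "player \<Rightarrow> 'a graph \<Rightarrow> nat" where
  "stripe_value p G =
     (if finite (verts G) \<and> end_vertices G \<noteq> {}
      then best p ((\<lambda>v. best (opponent p)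
             ((\<lambda>C. 1 + stripe_value p (induced_subgraph G (verts G - verts C))) ` P3_copies G v))
           ` end_vertices G)
      else 0)"
  by auto
termination
proof (relation "measure (\<lambda>(p, G). card (verts G))", goal_cases)
  case 1
  then show ?case by simp
next
  case (2 p G v C)
  then have "v \<in> verts G" "v \<in> verts C" "finite (verts G)"
    by (auto simp: end_vertices_def P3_copies_def)
  then have "verts G \<inter> (verts G - verts C) \<subset> verts G"
    by auto
  with \<open>finite (verts G)\<close> show ?case
    by (simp add: induced_subgraph_def psubset_card_mono)
qed

declare stripe_value.simps [simp del]

text \<open>All the sets to which \<open>best\<close> is applied are finite.\<close>

lemma finite_P3_copies:
  assumes "finite (verts G)"
  shows "finite (P3_copies G v)"
proof -
  have "P3_copies G v \<subseteq>
      (\<lambda>(a, b). Graph {v, a, b} {{v, a}, {a, b}}) ` (verts G \<times> verts G)"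
    by (auto simp: P3_copies_def subgraph_def)
  with assms show ?thesis
    by (meson finite_SigmaI finite_imageI finite_subset)
qed

lemma finite_end_vertices: "finite (verts G) \<Longrightarrow> finite (end_vertices G)"
  by (simp add: end_vertices_def)

end

theory Submission
  imports Defs
begin

text \<open>A position of the game on the \<open>2 \<times> m\<close> grid is a set of remaining vertices of
  the infinite ladder, and each of the four inequalities hidden in the two values is a strategy
  for one of the players.

  \<^item> \<^bold>\<open>Minimizer initiates, upper bound\<close>
  (\<open>Minimizer_stair_le\<close>). He eats the ladder from one end. Every position he meets
  consists of two left-aligned rows of nearly equal lengths plus isolated vertices, and he picks
  vertices so that whatever path is taken, an end vertex is left isolated often enough that on
  average about four vertices are used up per copy.

  \<^item> \<^bold>\<open>Maximizer initiates, lower bound\<close>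
  (\<open>Maximizer_stair_ge\<close>). She also eats from one end, always choosing the last vertex
  of the longer row; a row that protrudes by two or more leaves the responder no choice, so at
  most two columns are lost per copy on average.

  \<^item> \<^bold>\<open>Minimizer responds, upper bound\<close>
  (\<open>Maximizer_columns_le\<close>). Any position, whatever its shape, that occupies
  \<open>n\<close> consecutive columns has value at most \<open>\<lfloor>n/2\<rfloor>\<close>. He
  answers so as to disconnect one column from both neighbours, at a place where rounding down the
  numbers of columns on either side loses a whole copy; the value is additive over the two sides.

  \<^item> \<^bold>\<open>Maximizer responds, lower bound\<close>
  (\<open>Minimizer_strip_ge\<close>). She partitions the ladder into \<open>2 \<times> 2\<close>
  blocks. In each block every vertex starts a path of the block, so she can always answer with a
  path that meets at most one intact block, and there are \<open>\<lfloor>m/2\<rfloor>\<close>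
  blocks. For odd \<open>m \<ge> 3\<close> one more copy is needed: her first answer leaves,
  besides \<open>(m - 3)/2\<close> blocks, three vertices forming an L. The only vertex of the L
  from which no path of the L starts is its corner, and if the initiator picks the corner, she
  takes a path that turns the L and the adjacent block into a new L
  (\<open>Minimizer_tromino_ge\<close>).

  The isolated vertices of the first two strategies and the two sides of the third one are handled
  by additivity of the value over disconnected unions (\<open>val_disconnected\<close>), which
  holds because the same player initiates in all rounds and the responder has to answer in the
  component of the chosen vertex.\<close>

section \<open>The game on the vertex sets of a graph\<close>

text \<open>Every position is an induced subgraph of the starting graph. Fixing a relation \<open>R\<close>
  and varying only the vertex set makes the remaining graph after a round a plain set difference.\<close>

definition graph_on :: "('a \<Rightarrow> 'a \<Rightarrow> bool) \<Rightarrow> 'a set \<Rightarrow> 'a graph" where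
  "graph_on R S = Graph S {{u, v} | u v. u \<in> S \<and> v \<in> S \<and> R u v}"

definition path3 :: "('a \<Rightarrow> 'a \<Rightarrow> bool) \<Rightarrow> 'a set \<Rightarrow> 'a \<Rightarrow> 'a \<Rightarrow> 'a \<Rightarrow> bool" where
  "path3 R S v a b \<longleftrightarrow> v \<in> S \<and> a \<in> S \<and> b \<in> S \<and> v \<noteq> a \<and> v \<noteq> b \<and> a \<noteq> b \<and> R v a \<and> R a b"

abbreviation val :: "('a \<Rightarrow> 'a \<Rightarrow> bool) \<Rightarrow> player \<Rightarrow> 'a set \<Rightarrow> nat" where
  "val R p S \<equiv> stripe_value p (graph_on R S)"

definition reply_val :: "('a \<Rightarrow> 'a \<Rightarrow> bool) \<Rightarrow> player \<Rightarrow> 'a set \<Rightarrow> 'a \<Rightarrow> nat" where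
  "reply_val R p S v =
     best (opponent p) ((\<lambda>(a, b). Suc (val R p (S - {v, a, b}))) ` {(a, b). path3 R S v a b})"

definition ends :: "('a \<Rightarrow> 'a \<Rightarrow> bool) \<Rightarrow> 'a set \<Rightarrow> 'a set" where
  "ends R S = {v. \<exists>a b. path3 R S v a b}"

lemma doubleton_in_edges_graph_on:
  assumes "symp R"
  shows "{u, v} \<in> edges (graph_on R S) \<longleftrightarrow> u \<in> S \<and> v \<in> S \<and> R u v"
  using assms by (auto simp: graph_on_def doubleton_eq_iff dest: sympD)

lemma P3_copies_graph_on:
  assumes "symp R"
  shows "P3_copies (graph_on R S) v =
    (\<lambda>(a, b). Graph {v, a, b} {{v, a}, {a, b}}) ` {(a, b). path3 R S v a b}"
  using doubleton_in_edges_graph_on[OF assms]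
  by (auto simp: P3_copies_def subgraph_def path3_def graph_on_def image_iff)

lemma end_vertices_graph_on:
  assumes "symp R"
  shows "end_vertices (graph_on R S) = ends R S"
  by (auto simp: end_vertices_def P3_copies_graph_on[OF assms] ends_def)
     (auto simp: path3_def graph_on_def)

lemma induced_subgraph_graph_on:
  "induced_subgraph (graph_on R S) (S - X) = graph_on R (S - X)"
  by (auto simp: induced_subgraph_def graph_on_def)

lemma val_rec:
  assumes "symp R" "finite S"
  shows "val R p S = (if ends R S = {} then 0 else best p (reply_val R p S ` ends R S))"
proof -
  have "verts (graph_on R S) = S" by (simp add: graph_on_def)
  then show ?thesis
    using assms(2)
    by (subst stripe_value.simps)
       (simp add: end_vertices_graph_on[OF assms(1)] P3_copies_graph_on[OF assms(1)]
          reply_val_def[abs_def] image_image induced_subgraph_graph_on case_prod_unfold)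
qed

lemma finite_ends: "finite S \<Longrightarrow> finite (ends R S)"
  by (rule finite_subset[of _ S]) (auto simp: ends_def path3_def)

lemma finite_replies: "finite S \<Longrightarrow> finite {(a, b). path3 R S v a b}"
  by (rule finite_subset[of _ "S \<times> S"]) (auto simp: path3_def)

lemma ends_subset: "ends R S \<subseteq> S"
  by (auto simp: ends_def path3_def)

lemma card_reply:
  assumes "finite S" "path3 R S v a b"
  shows "card (S - {v, a, b}) < card S"
  using assms by (intro psubset_card_mono) (auto simp: path3_def)

text \<open>The next four rules turn a one-round strategy for one player into a bound on the value: the player
  who is bounding names a single move, and has to deal with all moves of the other one.\<close>

lemma val_Minimizer_le:
  assumes "symp R" "finite S" "v \<in> ends R S"
    and "\<And>a b. path3 R S v a b \<Longrightarrow> Suc (val R Minimizer (S - {v, a, b})) \<le> k"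
  shows "val R Minimizer S \<le> k"
proof -
  have "reply_val R Minimizer S v \<le> k"
    using assms(2-4) finite_replies[of S R v]
    by (auto simp: reply_val_def ends_def intro!: Max.boundedI)
  moreover have "val R Minimizer S \<le> reply_val R Minimizer S v"
    using assms(1-3) finite_ends[of S R] by (subst val_rec) auto
  ultimately show ?thesis by linarith
qed

lemma val_Minimizer_ge:
  assumes "symp R" "finite S" "ends R S \<noteq> {}"
    and "\<And>v. v \<in> ends R S \<Longrightarrow> \<exists>a b. path3 R S v a b \<and> k \<le> Suc (val R Minimizer (S - {v, a, b}))"
  shows "k \<le> val R Minimizer S"
proof -
  have "k \<le> reply_val R Minimizer S v" if "v \<in> ends R S" for v
    using assms(4)[OF that] finite_replies[of S R v] assms(2)
    by (force simp: reply_val_def intro: Max_ge_iff[THEN iffD2])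
  then show ?thesis
    using assms(1-3) finite_ends[of S R] by (subst val_rec) auto
qed

lemma val_Maximizer_ge:
  assumes "symp R" "finite S" "v \<in> ends R S"
    and "\<And>a b. path3 R S v a b \<Longrightarrow> k \<le> Suc (val R Maximizer (S - {v, a, b}))"
  shows "k \<le> val R Maximizer S"
proof -
  have "k \<le> reply_val R Maximizer S v"
    using assms(2-4) finite_replies[of S R v]
    by (auto simp: reply_val_def ends_def intro!: Min.boundedI)
  moreover have "reply_val R Maximizer S v \<le> val R Maximizer S"
    using assms(1-3) finite_ends[of S R] by (subst val_rec) auto
  ultimately show ?thesis by linarith
qed

lemma val_Maximizer_le:
  assumes "symp R" "finite S"
    and "\<And>v. v \<in> ends R S \<Longrightarrow> \<exists>a b. path3 R S v a b \<and> Suc (val R Maximizer (S - {v, a, b})) \<le> k"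
  shows "val R Maximizer S \<le> k"
proof -
  have "reply_val R Maximizer S v \<le> k" if "v \<in> ends R S" for v
    using assms(3)[OF that] finite_replies[of S R v] assms(2)
    by (force simp: reply_val_def intro: Min_le_iff[THEN iffD2])
  then show ?thesis
    using assms(1-2) finite_ends[of S R] by (subst val_rec) auto
qed

lemma best_add:
  assumes "finite A" "A \<noteq> {}"
  shows "best p ((\<lambda>x. f x + k) ` A) = best p (f ` A) + (k::nat)"
proof -
  have "mono (\<lambda>x. x + k)" by (auto intro: monoI)
  from mono_Max_commute[OF this, of "f ` A"] mono_Min_commute[OF this, of "f ` A"] assms
  show ?thesis by (cases p) (simp_all add: image_image)
qed

lemma best_Un_same:
  assumes "finite A" "finite B" "A = {} \<or> best p A = k" "B = {} \<or> best p B = k" "A \<union> B \<noteq> {}"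
  shows "best p (A \<union> B) = k"
  using assms by (cases p; cases "A = {}"; cases "B = {}") (auto simp: Max_Un Min_Un)

section \<open>Additivity over disconnected unions and invariance under isomorphism\<close>

lemma path3_disconnected:
  assumes "symp R" "\<And>u w. u \<in> S \<Longrightarrow> w \<in> T \<Longrightarrow> \<not> R u w" "v \<in> S" "S \<inter> T = {}"
  shows "path3 R (S \<union> T) v a b \<longleftrightarrow> path3 R S v a b"
  using assms by (auto simp: path3_def dest: sympD)

lemma ends_disconnected:
  assumes "symp R" "\<And>u w. u \<in> S \<Longrightarrow> w \<in> T \<Longrightarrow> \<not> R u w" "S \<inter> T = {}"
  shows "ends R (S \<union> T) = ends R S \<union> ends R T"
proof -
  have "\<not> R u w" if "u \<in> T" "w \<in> S" for u w
    using that assms(1,2) by (auto dest: sympD)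
  from path3_disconnected[OF assms(1) this, of _] assms(3)
  have T: "path3 R (S \<union> T) v a b \<longleftrightarrow> path3 R T v a b" if "v \<in> T" for v a b
    using that by (metis Int_commute Un_commute)
  have S: "path3 R (S \<union> T) v a b \<longleftrightarrow> path3 R S v a b" if "v \<in> S" for v a b
    using that path3_disconnected[OF assms(1,2) _ assms(3)] by blast
  have V: "path3 R X v a b \<Longrightarrow> v \<in> X" for X v a b by (simp add: path3_def)
  show ?thesis
    unfolding ends_def using S T V by blast
qed

text \<open>The responder cannot leave the part \<open>S\<close> that contains the chosen vertex, so the other
  part contributes the same constant to each of the possible answers.\<close>

lemma reply_val_disconnected:
  assumes "symp R" "finite S" "S \<inter> T = {}" "\<And>u w. u \<in> S \<Longrightarrow> w \<in> T \<Longrightarrow> \<not> R u w" "v \<in> ends R S"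
    and IH: "\<And>S'. S' \<subseteq> S \<Longrightarrow> card S' < card S \<Longrightarrow> val R p (S' \<union> T) = val R p S' + val R p T"
  shows "reply_val R p (S \<union> T) v = reply_val R p S v + val R p T"
proof -
  have vS: "v \<in> S" using assms(5) ends_subset[of R S] by blast
  have eq: "val R p (S \<union> T - {v, a, b}) = val R p (S - {v, a, b}) + val R p T"
    if p3: "path3 R S v a b" for a b
  proof -
    have "S \<union> T - {v, a, b} = (S - {v, a, b}) \<union> T"
      using p3 assms(3) by (auto simp: path3_def)
    then show ?thesis using IH[OF Diff_subset card_reply[OF assms(2) p3]] by simp
  qed
  have "(\<lambda>(a, b). Suc (val R p (S \<union> T - {v, a, b}))) ` {(a, b). path3 R (S \<union> T) v a b}
      = (\<lambda>x. (case x of (a, b) \<Rightarrow> Suc (val R p (S - {v, a, b}))) + val R p T) ` {(a, b). path3 R S v a b}"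
    using path3_disconnected[OF assms(1,4) vS assms(3)] eq
    by (intro image_cong) auto
  moreover have "{(a, b). path3 R S v a b} \<noteq> {}"
    using assms(5) by (auto simp: ends_def)
  ultimately show ?thesis
    using best_add[OF finite_replies[OF assms(2)]] by (simp add: reply_val_def)
qed

text \<open>By the previous lemma, for each choice of the initiator the value of the round is the value within
  one part plus the value of the other part. Optimizing over the choices inside either part with a
  legal choice gives the same sum, hence so does optimizing over both.\<close>

lemma val_disconnected:
  assumes "symp R" "finite S" "finite T" "S \<inter> T = {}"
    and "\<And>u w. u \<in> S \<Longrightarrow> w \<in> T \<Longrightarrow> \<not> R u w"
  shows "val R p (S \<union> T) = val R p S + val R p T"
  using assms(2-)
proof (induction "card S + card T" arbitrary: S T rule: less_induct)
  case less
  have TS: "\<not> R u w" if "u \<in> T" "w \<in> S" for u w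
    using that less.prems(4) assms(1) by (auto dest: sympD)
  have IHS: "val R p (S' \<union> T) = val R p S' + val R p T" if "S' \<subseteq> S" "card S' < card S" for S'
    using that less.prems by (intro less.hyps) (auto intro: finite_subset)
  have IHT: "val R p (T' \<union> S) = val R p T' + val R p S" if "T' \<subseteq> T" "card T' < card T" for T'
    using that less.prems TS by (intro less.hyps) (auto intro: finite_subset)
  have ends: "ends R (S \<union> T) = ends R S \<union> ends R T"
    by (rule ends_disconnected[OF assms(1) less.prems(4,3)])
  note fin = finite_ends[OF less.prems(1), of R] finite_ends[OF less.prems(2), of R]
  let ?g = "reply_val R p (S \<union> T)" and ?k = "val R p S + val R p T"
  have S: "?g v = reply_val R p S v + val R p T" if "v \<in> ends R S" for v
    by (rule reply_val_disconnected[OF assms(1) less.prems(1,3,4) that IHS])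
  have T: "?g v = reply_val R p T v + val R p S" if "v \<in> ends R T" for v
  proof -
    have "T \<inter> S = {}" using less.prems(3) by blast
    from reply_val_disconnected[OF assms(1) less.prems(2) this TS that IHT]
    show ?thesis by (simp add: Un_commute)
  qed
  show ?case
  proof (cases "ends R (S \<union> T) = {}")
    case True
    then show ?thesis
      using ends less.prems(1,2) assms(1) by (simp add: val_rec)
  next
    case False
    have "best p (?g ` ends R S) = ?k" if "ends R S \<noteq> {}"
    proof -
      have "?g ` ends R S = (\<lambda>v. reply_val R p S v + val R p T) ` ends R S"
        using S by (intro image_cong) auto
      then show ?thesis
        using best_add[OF fin(1) that] val_rec[OF assms(1) less.prems(1), of p] that by simp
    qed
    moreover have "best p (?g ` ends R T) = ?k" if "ends R T \<noteq> {}"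
    proof -
      have "?g ` ends R T = (\<lambda>v. reply_val R p T v + val R p S) ` ends R T"
        using T by (intro image_cong) auto
      then show ?thesis
        using best_add[OF fin(2) that] val_rec[OF assms(1) less.prems(2), of p] that by simp
    qed
    ultimately have "best p (?g ` ends R S \<union> ?g ` ends R T) = ?k"
      using False fin unfolding ends by (intro best_Un_same) auto
    moreover have "val R p (S \<union> T) = best p (?g ` ends R (S \<union> T))"
      using False less.prems(1,2) by (subst val_rec[OF assms(1)]) simp_all
    ultimately show ?thesis
      by (simp add: ends image_Un)
  qed
qed

lemma val_insert_isolated:
  assumes "symp R" "finite S" "\<And>u. u \<in> S \<Longrightarrow> \<not> R x u" "x \<notin> S"
  shows "val R p (insert x S) = val R p S"
proof -
  have "ends R {x} = {}" by (auto simp: ends_def path3_def)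
  then have "val R p {x} = 0" using val_rec[OF assms(1), of "{x}" p] by simp
  then show ?thesis using val_disconnected[of R "{x}" S p] assms by auto
qed

lemma val_image:
  assumes "symp R" "symp R'" "finite S" "inj_on f S"
    and "\<And>u w. u \<in> S \<Longrightarrow> w \<in> S \<Longrightarrow> R' (f u) (f w) \<longleftrightarrow> R u w"
  shows "val R' p (f ` S) = val R p S"
  using assms(3-)
proof (induction "card S" arbitrary: S rule: less_induct)
  case less
  have p3: "path3 R' (f ` S) (f v) (f a) (f b) \<longleftrightarrow> path3 R S v a b"
    if "v \<in> S" "a \<in> S" "b \<in> S" for v a b
    using that less.prems by (auto simp: path3_def inj_on_eq_iff)
  have reply: "reply_val R' p (f ` S) (f v) = reply_val R p S v" if "v \<in> S" for v
  proof -
    have "{(a, b). path3 R' (f ` S) (f v) a b} = map_prod f f ` {(a, b). path3 R S v a b}"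
    proof (intro equalityI subsetI)
      fix x assume "x \<in> {(a, b). path3 R' (f ` S) (f v) a b}"
      then obtain a b where x: "x = (f a, f b)" "a \<in> S" "b \<in> S" "path3 R' (f ` S) (f v) (f a) (f b)"
        by (auto simp: path3_def)
      then show "x \<in> map_prod f f ` {(a, b). path3 R S v a b}"
        using p3[OF that] by auto
    next
      fix x assume "x \<in> map_prod f f ` {(a, b). path3 R S v a b}"
      then obtain a b where x: "x = (f a, f b)" "path3 R S v a b" by auto
      then have "a \<in> S" "b \<in> S" by (auto simp: path3_def)
      then show "x \<in> {(a, b). path3 R' (f ` S) (f v) a b}"
        using x p3[OF that] by auto
    qed
    moreover have "val R' p (f ` S - {f v, f a, f b}) = val R p (S - {v, a, b})"
      if "path3 R S v a b" for a b
    proof -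
      have "f ` (S - {v, a, b}) = f ` S - f ` {v, a, b}"
        using less.prems(2) that by (intro inj_on_image_set_diff[of _ S]) (auto simp: path3_def)
      then have "f ` S - {f v, f a, f b} = f ` (S - {v, a, b})" by simp
      then show ?thesis
        using less.hyps[of "S - {v, a, b}"] card_reply[OF less.prems(1) that] less.prems
        by (auto intro: inj_on_subset)
    qed
    ultimately show ?thesis
      by (auto simp: reply_val_def image_image intro!: arg_cong[of _ _ "best (opponent p)"] image_cong)
  qed
  have ends: "ends R' (f ` S) = f ` ends R S"
  proof (intro equalityI subsetI)
    fix x assume "x \<in> ends R' (f ` S)"
    then obtain v a b where "x = f v" "v \<in> S" "a \<in> S" "b \<in> S" "path3 R' (f ` S) (f v) (f a) (f b)"
      by (auto simp: ends_def path3_def)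
    then show "x \<in> f ` ends R S" using p3 unfolding ends_def by blast
  next
    fix x assume "x \<in> f ` ends R S"
    then obtain v a b where x: "x = f v" "path3 R S v a b" by (auto simp: ends_def)
    then have "v \<in> S" "a \<in> S" "b \<in> S" by (auto simp: path3_def)
    then show "x \<in> ends R' (f ` S)" using x p3 unfolding ends_def by blast
  qed
  have "reply_val R' p (f ` S) ` f ` ends R S = reply_val R p S ` ends R S"
    using reply ends_subset[of R S] by (force simp: image_image intro!: image_cong)
  then show ?case
    using less.prems(1) assms(1,2) ends by (simp add: val_rec)
qed

section \<open>The ladder\<close>

text \<open>The ladder extends infinitely in both directions: integer columns make it invariant under
  reflections, and Boolean rows make the other row available as negation.\<close>

definition adj :: "bool \<times> int \<Rightarrow> bool \<times> int \<Rightarrow> bool" where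
  "adj u w \<longleftrightarrow> (fst u \<noteq> fst w \<and> snd u = snd w) \<or> (fst u = fst w \<and> \<bar>snd u - snd w\<bar> = 1)"

lemma symp_adj: "symp adj"
  by (auto simp: symp_def adj_def)

lemma edges_path_graph:
  "{i, j} \<in> edges (path_graph n) \<longleftrightarrow> (j = Suc i \<and> j < n) \<or> (i = Suc j \<and> i < n)"
  by (auto simp: path_graph_def doubleton_eq_iff)

lemma edges_cartesian_product:
  "{(x, y), (x', y')} \<in> edges (cartesian_product G H) \<longleftrightarrow>
     ({x, x'} \<in> edges G \<and> y = y' \<and> y \<in> verts H) \<or> (x = x' \<and> x \<in> verts G \<and> {y, y'} \<in> edges H)"
  (is "?e \<in> _ \<longleftrightarrow> ?rhs")
proof
  assume "?e \<in> edges (cartesian_product G H)"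
  then consider x1 x2 y1 where "?e = {(x1, y1), (x2, y1)}" "{x1, x2} \<in> edges G" "y1 \<in> verts H"
    | x1 y1 y2 where "?e = {(x1, y1), (x1, y2)}" "x1 \<in> verts G" "{y1, y2} \<in> edges H"
    unfolding cartesian_product_def by auto
  then show ?rhs
    by cases (auto simp: doubleton_eq_iff insert_commute)
next
  assume ?rhs
  then show "?e \<in> edges (cartesian_product G H)"
    unfolding cartesian_product_def by auto
qed

lemma grid_eq_graph_on:
  "grid k m = graph_on (\<lambda>u w. {u, w} \<in> edges (grid k m)) ({..<k} \<times> {..<m})"
proof -
  have "\<exists>u w. e = {u, w} \<and> u \<in> {..<k} \<times> {..<m} \<and> w \<in> {..<k} \<times> {..<m}" if "e \<in> edges (grid k m)" for e
    using that by (fastforce simp: grid_def cartesian_product_def path_graph_def doubleton_eq_iff)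
  moreover have "verts (grid k m) = {..<k} \<times> {..<m}"
    by (simp add: grid_def cartesian_product_def path_graph_def)
  ultimately show ?thesis
    by (cases "grid k m") (auto simp: graph_on_def; metis)
qed

lemma stripe_value_grid:
  "stripe_value p (grid 2 m) = val adj p (UNIV \<times> {0..<int m})"
proof -
  let ?f = "\<lambda>(x, y). (x = (1::nat), int y)"
  have im: "?f ` ({..<2} \<times> {..<m}) = UNIV \<times> {0..<int m}"
  proof (intro equalityI subsetI)
    fix x :: "bool \<times> int" assume "x \<in> UNIV \<times> {0..<int m}"
    then have "x = ?f (if fst x then 1 else 0, nat (snd x))" "nat (snd x) < m"
      by (auto simp: prod_eq_iff)
    then show "x \<in> ?f ` ({..<2} \<times> {..<m})"
      by (intro image_eqI[of _ _ "(if fst x then 1 else 0, nat (snd x))"]) simp_all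
  qed auto
  have edge: "adj (?f u) (?f w) \<longleftrightarrow> {u, w} \<in> edges (grid 2 m)"
    if "u \<in> {..<2} \<times> {..<m}" "w \<in> {..<2} \<times> {..<m}" for u w
  proof -
    obtain x y x' y' where uw: "u = (x, y)" "w = (x', y')" by (cases u; cases w)
    have "{u, w} \<in> edges (grid 2 m) \<longleftrightarrow>
        (y = y' \<and> (x' = Suc x \<or> x = Suc x')) \<or> (x = x' \<and> (y' = Suc y \<or> y = Suc y'))"
      using that unfolding uw
      by (simp add: edges_cartesian_product grid_def edges_path_graph) (auto simp: path_graph_def)
    then show ?thesis using that unfolding uw by (auto simp: adj_def less_2_cases_iff)
  qed
  have "val adj p (?f ` ({..<2} \<times> {..<m}))
      = val (\<lambda>u w. {u, w} \<in> edges (grid 2 m)) p ({..<2} \<times> {..<m})"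
  proof (rule val_image)
    show "inj_on ?f ({..<2} \<times> {..<m})" by (auto simp: inj_on_def less_2_cases_iff)
    show "symp (\<lambda>u w. {u, w} \<in> edges (grid 2 m))" by (auto simp: symp_def insert_commute)
  qed (use edge symp_adj in auto)
  then show ?thesis using grid_eq_graph_on[of 2 m] im by simp
qed

lemma adj_iff: "adj (r, i) w \<longleftrightarrow> w = (\<not> r, i) \<or> w = (r, i - 1) \<or> w = (r, i + 1)"
  by (cases w) (auto simp: adj_def)

lemma path3_adj:
  "path3 adj S (r, i) a b \<longleftrightarrow> (r, i) \<in> S \<and> a \<in> S \<and> b \<in> S \<and>
     (a = (\<not> r, i) \<and> (b = (\<not> r, i - 1) \<or> b = (\<not> r, i + 1)) \<or>
      a = (r, i - 1) \<and> (b = (\<not> r, i - 1) \<or> b = (r, i - 2)) \<or>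
      a = (r, i + 1) \<and> (b = (\<not> r, i + 1) \<or> b = (r, i + 2)))"
  by (auto simp: path3_def adj_iff)

lemma endsI: "path3 R S v a b \<Longrightarrow> v \<in> ends R S"
  by (auto simp: ends_def)

section \<open>Eating the ladder from one end\<close>

text \<open>Up to isolated vertices, these are the positions that arise when a strip is eaten from its right
  end.\<close>

definition stair :: "nat \<Rightarrow> nat \<Rightarrow> (bool \<times> int) set" where
  "stair p q = {(s, j). 0 \<le> j \<and> j < (if s then int p else int q)}"

lemma mem_stair [simp]: "(s, j) \<in> stair p q \<longleftrightarrow> 0 \<le> j \<and> j < (if s then int p else int q)"
  by (simp add: stair_def)

lemma finite_stair [simp]: "finite (stair p q)"
  by (rule finite_subset[of _ "UNIV \<times> {0..<int (max p q)}"]) (auto split: if_splits)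

lemma val_stair_swap: "val adj P (stair p q) = val adj P (stair q p)"
proof -
  have "stair p q = (\<lambda>(s, j). (\<not> s, j)) ` stair q p"
    by (force simp: image_iff stair_def split: if_splits)
  moreover have "val adj P ((\<lambda>(s, j). (\<not> s, j)) ` stair q p) = val adj P (stair q p)"
    by (rule val_image) (auto simp: symp_adj inj_on_def adj_def)
  ultimately show ?thesis by simp
qed

lemma val_no_path3: "finite S \<Longrightarrow> ends adj S = {} \<Longrightarrow> val adj P S = 0"
  by (simp add: val_rec symp_adj)

lemma val_empty: "val adj P {} = 0"
  by (rule val_no_path3) (simp_all add: ends_def path3_def)

lemma val_adj_insert_isolated:
  assumes "finite S" "(r, i) \<notin> S" "(\<not> r, i) \<notin> S" "(r, i - 1) \<notin> S" "(r, i + 1) \<notin> S"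
  shows "val adj P (insert (r, i) S) = val adj P S"
  using assms by (intro val_insert_isolated) (auto simp: symp_adj adj_iff)

lemma rectangle_corner_end:
  "(True, int n + 1) \<in> ends adj (stair (n + 2) (n + 2))"
  by (rule endsI[of _ _ _ "(False, int n + 1)" "(False, int n)"]) (simp add: path3_adj)

text \<open>When a corner of a full rectangle is chosen, the answer either leaves one row longer by one, or
  isolates the other corner, or runs straight along the row and makes the other row longer by
  three. Both initiators use this choice.\<close>

lemma rectangle_corner_replies:
  assumes "path3 adj (stair (n + 2) (n + 2)) (True, int n + 1) a b"
  shows "val adj P (stair (n + 2) (n + 2) - {(True, int n + 1), a, b})
      \<in> {val adj P (stair (n + 1) n), val adj P (stair n n)} \<union>
        (if n = 0 then {} else {val adj P (stair (n + 2) (n - 1))})"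
proof -
  let ?R = "stair (n + 2) (n + 2) - {(True, int n + 1), a, b}"
  from assms consider
    (1) "a = (False, int n + 1)" "b = (False, int n)"
    | (2) "a = (True, int n)" "b = (False, int n)"
    | (3) "a = (True, int n)" "b = (True, int n - 1)" "n > 0"
    by (auto simp: path3_adj split: if_splits)
  then show ?thesis
  proof cases
    case 1
    then have "?R = stair (n + 1) n"
      by (auto split: if_splits)
    then show ?thesis by simp
  next
    case 2
    then have "?R = insert (False, int n + 1) (stair n n)"
      by (auto split: if_splits)
    moreover have "val adj P (insert (False, int n + 1) (stair n n)) = val adj P (stair n n)"
      by (rule val_adj_insert_isolated) auto
    ultimately show ?thesis by simp
  next
    case 3
    then have "?R = stair (n - 1) (n + 2)"
      by (auto split: if_splits)
    then show ?thesis using 3 val_stair_swap by simp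
  qed
qed

text \<open>With a row protruding by three, choosing the second vertex from its end forces a path that goes
  inwards, so that the end vertex becomes isolated and is wasted. The hypothesis bounds what
  remains. For \<open>q = 0\<close> the position is a single copy.\<close>

lemma Minimizer_stair3_le:
  assumes "val adj Minimizer (stair q (q - 1)) \<le> q div 2"
  shows "val adj Minimizer (stair (q + 3) q) \<le> Suc (q div 2)"
proof (cases "q = 0")
  case True
  show ?thesis
  proof (rule val_Minimizer_le)
    show "(True, 2) \<in> ends adj (stair (q + 3) q)"
      by (rule endsI[of _ _ _ "(True, 1)" "(True, 0)"]) (simp add: path3_adj True)
    fix a b assume "path3 adj (stair (q + 3) q) (True, 2) a b"
    then have "a = (True, 1)" "b = (True, 0)"
      using True by (auto simp: path3_adj split: if_splits)
    then have rest: "stair (q + 3) q - {(True, 2), a, b} = {}"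
      using True by (auto split: if_splits)
    show "Suc (val adj Minimizer (stair (q + 3) q - {(True, 2), a, b})) \<le> Suc (q div 2)"
      unfolding rest by (simp add: val_empty)
  qed (simp_all add: symp_adj)
next
  case False
  then obtain n where q: "q = Suc n" by (cases q) auto
  show ?thesis
  proof (rule val_Minimizer_le)
    show "(True, int q + 1) \<in> ends adj (stair (q + 3) q)"
      by (rule endsI[of _ _ _ "(True, int q)" "(True, int n)"]) (simp add: path3_adj q)
    fix a b assume "path3 adj (stair (q + 3) q) (True, int q + 1) a b"
    then have "a = (True, int q)" "b = (True, int q - 1)"
      using q by (auto simp: path3_adj split: if_splits)
    then have "stair (q + 3) q - {(True, int q + 1), a, b} = insert (True, int q + 2) (stair (q - 1) q)"
      using q by (auto split: if_splits)
    moreover have "val adj Minimizer (insert (True, int q + 2) (stair (q - 1) q))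
        = val adj Minimizer (stair (q - 1) q)"
      by (rule val_adj_insert_isolated) (auto simp: q)
    ultimately show "Suc (val adj Minimizer (stair (q + 3) q - {(True, int q + 1), a, b})) \<le> Suc (q div 2)"
      using assms val_stair_swap[of Minimizer "q - 1" q] by simp
  qed (simp_all add: symp_adj)
qed

text \<open>A rectangle with at least two columns is attacked at a corner. If a row of such a rectangle
  protrudes by one, the vertex next to its end is chosen: no path can start towards the end, so the protruding vertex becomes isolated, and
  otherwise the possible answers are those to a corner of the rectangle.\<close>

lemma Minimizer_stair_le:
  "val adj Minimizer (stair p p) \<le> Suc p div 2 \<and> val adj Minimizer (stair (p + 1) p) \<le> Suc p div 2"
proof (induction p rule: less_induct)
  case (less p)
  have stair3: "val adj Minimizer (stair (n + 2) (n - 1)) \<le> Suc n div 2" if "0 < n" "n < p" for n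
  proof -
    obtain q where q: "n = Suc q" using \<open>0 < n\<close> by (cases n) auto
    have "val adj Minimizer (stair q (q - 1)) \<le> q div 2"
    proof (cases q)
      case 0
      have "stair 0 0 = {}" by (auto split: if_splits)
      then show ?thesis using 0 by (simp add: val_empty)
    next
      case (Suc q')
      then show ?thesis using less.IH[of q'] q \<open>n < p\<close> by simp
    qed
    from Minimizer_stair3_le[OF this] show ?thesis
      using q by (simp add: numeral_3_eq_3)
  qed
  consider "p = 0" | "p = 1" | n where "p = n + 2"
    by (metis One_nat_def Suc_1 add_2_eq_Suc' less_2_cases_iff less_Suc_eq_le nat_le_iff_add not_less add.commute)
  then show ?case
  proof cases
    case 1
    have "ends adj (stair 1 0) = {}" "ends adj (stair 0 0) = {}"
      by (auto simp: ends_def path3_adj split: if_splits)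
    then show ?thesis using 1 by (simp add: val_no_path3)
  next
    case 2
    have "ends adj (stair 1 1) = {}"
      by (auto simp: ends_def path3_adj split: if_splits)
    moreover have "val adj Minimizer (stair 2 1) \<le> 1"
    proof (rule val_Minimizer_le)
      show "(True, 1) \<in> ends adj (stair 2 1)"
        by (rule endsI[of _ _ _ "(True, 0)" "(False, 0)"]) (simp add: path3_adj)
      fix a b assume "path3 adj (stair 2 1) (True, 1) a b"
      then have "a = (True, 0)" "b = (False, 0)"
        by (auto simp: path3_adj split: if_splits)
      then have rest: "stair 2 1 - {(True, 1), a, b} = {}"
        by (auto split: if_splits)
      show "Suc (val adj Minimizer (stair 2 1 - {(True, 1), a, b})) \<le> 1"
        unfolding rest by (simp add: val_empty)
    qed (simp_all add: symp_adj)
    ultimately show ?thesis using 2 by (simp add: val_no_path3 numeral_2_eq_2)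
  next
    case 3
    note IH = less.IH[of n] stair3[of n]
    have "val adj Minimizer (stair (n + 2) (n + 2)) \<le> Suc p div 2"
    proof (rule val_Minimizer_le)
      fix a b assume "path3 adj (stair (n + 2) (n + 2)) (True, int n + 1) a b"
      from rectangle_corner_replies[OF this, of Minimizer] IH 3
      show "Suc (val adj Minimizer (stair (n + 2) (n + 2) - {(True, int n + 1), a, b})) \<le> Suc p div 2"
        by (auto split: if_splits)
    qed (simp_all add: symp_adj rectangle_corner_end[simplified])
    moreover have "val adj Minimizer (stair (n + 3) (n + 2)) \<le> Suc p div 2"
    proof (rule val_Minimizer_le)
      let ?S = "stair (n + 3) (n + 2)" and ?v = "(True, int n + 1)"
      show "?v \<in> ends adj ?S"
        by (rule endsI[of _ _ _ "(False, int n + 1)" "(False, int n)"]) (simp add: path3_adj)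
      fix a b assume p3: "path3 adj ?S ?v a b"
      then have *: "path3 adj (stair (n + 2) (n + 2)) ?v a b"
        by (auto simp: path3_adj split: if_splits)
      have rest: "?S - {?v, a, b} = insert (True, int n + 2) (stair (n + 2) (n + 2) - {?v, a, b})"
        using * by (auto simp: path3_adj split: if_splits)
      have "val adj Minimizer (?S - {?v, a, b}) = val adj Minimizer (stair (n + 2) (n + 2) - {?v, a, b})"
        unfolding rest by (rule val_adj_insert_isolated) auto
      moreover have "Suc (val adj Minimizer (stair (n + 2) (n + 2) - {?v, a, b})) \<le> Suc p div 2"
        using rectangle_corner_replies[OF *, of Minimizer] IH 3 by (auto split: if_splits)
      ultimately show "Suc (val adj Minimizer (?S - {?v, a, b})) \<le> Suc p div 2"
        by (simp only:)
    qed (simp_all add: symp_adj)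
    ultimately show ?thesis using 3 by (simp add: eval_nat_numeral)
  qed
qed

text \<open>The end of the longer row is chosen throughout. If it protrudes by two, the forced path uses up
  the protruding vertices and one column; if it protrudes by three, the forced path leaves a full
  rectangle, so a copy is gained at no cost in columns. This gain compensates for the straight
  answer to a corner, which costs three columns.\<close>

lemma Maximizer_stair_ge:
  "p div 2 \<le> val adj Maximizer (stair p p) \<and>
   p div 2 \<le> val adj Maximizer (stair (p + 1) p) \<and>
   p div 2 \<le> val adj Maximizer (stair (p + 2) p) \<and>
   Suc (p div 2) \<le> val adj Maximizer (stair (p + 3) p)"
proof (induction p rule: less_induct)
  case (less p)
  have A: "p div 2 \<le> val adj Maximizer (stair p p) \<and>
   p div 2 \<le> val adj Maximizer (stair (p + 1) p) \<and>
   p div 2 \<le> val adj Maximizer (stair (p + 2) p)"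
  proof (cases "p < 2")
    case False
    then obtain n where p: "p = n + 2" using le_Suc_ex[of 2 p] by auto
    have half: "n div 2 \<le> Suc n div 2" by (simp add: div_le_mono)
    have "p div 2 \<le> val adj Maximizer (stair (n + 2) (n + 2))"
    proof (rule val_Maximizer_ge)
      fix a b assume "path3 adj (stair (n + 2) (n + 2)) (True, int n + 1) a b"
      moreover have "n div 2 \<le> val adj Maximizer (stair (n + 2) (n - 1))" if "n > 0"
        using less.IH[of "n - 1"] p that by (cases n) (auto simp: numeral_3_eq_3)
      ultimately show "p div 2 \<le> Suc (val adj Maximizer (stair (n + 2) (n + 2) - {(True, int n + 1), a, b}))"
        using rectangle_corner_replies[of n a b Maximizer] less.IH[of n] p by (auto split: if_splits)
    qed (simp_all add: symp_adj rectangle_corner_end[simplified])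
    moreover have "p div 2 \<le> val adj Maximizer (stair (n + 3) (n + 2))"
    proof (rule val_Maximizer_ge)
      let ?S = "stair (n + 3) (n + 2)" and ?v = "(True, int n + 2)"
      show "?v \<in> ends adj ?S"
        by (rule endsI[of _ _ _ "(True, int n + 1)" "(False, int n + 1)"]) (simp add: path3_adj)
      fix a b assume "path3 adj ?S ?v a b"
      then consider (1) "a = (True, int n + 1)" "b = (False, int n + 1)"
        | (2) "a = (True, int n + 1)" "b = (True, int n)"
        by (auto simp: path3_adj split: if_splits)
      then show "p div 2 \<le> Suc (val adj Maximizer (?S - {?v, a, b}))"
      proof cases
        case 1
        then have rest: "?S - {?v, a, b} = stair (n + 1) (n + 1)"
          by (auto split: if_splits)
        have "Suc n div 2 \<le> val adj Maximizer (stair (n + 1) (n + 1))"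
          using less.IH[of "n + 1"] p by simp
        then show ?thesis unfolding rest using p half by linarith
      next
        case 2
        then have rest: "?S - {?v, a, b} = stair n (n + 2)"
          by (auto split: if_splits)
        show ?thesis unfolding rest val_stair_swap[of Maximizer n] using less.IH[of n] p by simp
      qed
    qed (simp_all add: symp_adj)
    moreover have "p div 2 \<le> val adj Maximizer (stair (n + 4) (n + 2))"
    proof (rule val_Maximizer_ge)
      let ?S = "stair (n + 4) (n + 2)" and ?v = "(True, int n + 3)"
      show "?v \<in> ends adj ?S"
        by (rule endsI[of _ _ _ "(True, int n + 2)" "(True, int n + 1)"]) (simp add: path3_adj)
      fix a b assume "path3 adj ?S ?v a b"
      then have "a = (True, int n + 2)" "b = (True, int n + 1)"
        by (auto simp: path3_adj split: if_splits)
      then have rest: "?S - {?v, a, b} = stair (n + 1) (n + 2)"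
        by (auto split: if_splits)
      have "Suc n div 2 \<le> val adj Maximizer (stair (n + 2) (n + 1))"
        using less.IH[of "n + 1"] p by simp
      then show "p div 2 \<le> Suc (val adj Maximizer (?S - {?v, a, b}))"
        unfolding rest val_stair_swap[of Maximizer "n + 1"] using p half by linarith
    qed (simp_all add: symp_adj)
    ultimately show ?thesis using p by (simp add: eval_nat_numeral)
  qed simp
  moreover have "Suc (p div 2) \<le> val adj Maximizer (stair (p + 3) p)"
  proof (rule val_Maximizer_ge)
    let ?S = "stair (p + 3) p" and ?v = "(True, int p + 2)"
    show "?v \<in> ends adj ?S"
      by (rule endsI[of _ _ _ "(True, int p + 1)" "(True, int p)"]) (simp add: path3_adj)
    fix a b assume "path3 adj ?S ?v a b"
    then have "a = (True, int p + 1)" "b = (True, int p)"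
      by (auto simp: path3_adj split: if_splits)
    then have rest: "?S - {?v, a, b} = stair p p"
      by (auto split: if_splits)
    show "Suc (p div 2) \<le> Suc (val adj Maximizer (?S - {?v, a, b}))"
      unfolding rest using A by simp
  qed (simp_all add: symp_adj)
  ultimately show ?case by blast
qed

section \<open>Responding by cutting off a column\<close>

lemma val_split_columns:
  assumes "finite S" "\<And>r. (r, k - 1) \<in> S \<Longrightarrow> (r, k) \<notin> S"
  shows "val adj P S = val adj P {u \<in> S. snd u < k} + val adj P {u \<in> S. k \<le> snd u}"
proof -
  have "\<not> adj u w" if u: "u \<in> {u \<in> S. snd u < k}" and w: "w \<in> {u \<in> S. k \<le> snd u}" for u w
  proof
    assume "adj u w"
    then have "u = (fst u, k - 1)" "w = (fst u, k)"
      using u w by (auto simp: adj_def prod_eq_iff)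
    then show False using assms(2)[of "fst u"] u w by auto
  qed
  then have "val adj P ({u \<in> S. snd u < k} \<union> {u \<in> S. k \<le> snd u})
      = val adj P {u \<in> S. snd u < k} + val adj P {u \<in> S. k \<le> snd u}"
    using assms(1) by (intro val_disconnected) (auto simp: symp_adj)
  moreover have "{u \<in> S. snd u < k} \<union> {u \<in> S. k \<le> snd u} = S" by auto
  ultimately show ?thesis by simp
qed

text \<open>Vertices in the same column may remain adjacent: a single column contains no three vertices.\<close>

definition cut_column :: "(bool \<times> int) set \<Rightarrow> int \<Rightarrow> bool" where
  "cut_column S k \<longleftrightarrow> (\<forall>r. (r, k) \<in> S \<longrightarrow> (r, k - 1) \<notin> S \<and> (r, k + 1) \<notin> S)"

text \<open>If column \<open>k\<close> is cut in a position on \<open>n\<close> columns, the two sides have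
  \<open>n - 1\<close> columns together, and rounding down both halves loses a full copy unless
  both sides are even. So for even \<open>n\<close> any cut column will do, and the column of the
  chosen vertex \<open>v\<close> can be cut: either the path takes both its vertices, or the other
  vertex has no horizontal neighbour. For odd \<open>n\<close> the cut column must have an odd
  number of columns to its left. If the column of \<open>v\<close> has not, a neighbouring column
  has, and connectedness of the position makes it possible to empty that column by a path starting
  at \<open>v\<close>.\<close>

lemma cutting_reply:
  assumes S: "S \<subseteq> UNIV \<times> {a..<a + int n}" and v: "v \<in> ends adj S"
    and conn: "\<And>k. a < k \<Longrightarrow> k < a + int n \<Longrightarrow> \<exists>r. (r, k - 1) \<in> S \<and> (r, k) \<in> S"
  shows "\<exists>x y k. path3 adj S v x y \<and> a \<le> k \<and> k < a + int n \<and> (even n \<or> odd (k - a)) \<and>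
    cut_column (S - {v, x, y}) k"
proof -
  obtain r c where rc: "v = (r, c)" by (cases v)
  from v obtain x y where xy: "path3 adj S v x y" by (auto simp: ends_def)
  then have c: "v \<in> S" "a \<le> c" "c < a + int n" using S rc by (auto simp: path3_def)
  show ?thesis
  proof (cases "even n \<or> odd (c - a)")
    case True
    show ?thesis
    proof (cases "(\<not> r, c) \<in> S \<and> ((\<not> r, c - 1) \<in> S \<or> (\<not> r, c + 1) \<in> S)")
      case nbr: True
      then obtain w where "w = (\<not> r, c - 1) \<or> w = (\<not> r, c + 1)" "w \<in> S" by blast
      then have "path3 adj S v (\<not> r, c) w"
        using nbr c(1) by (auto simp: path3_adj rc)
      moreover have "cut_column (S - {v, (\<not> r, c), w}) c"
        using rc by (auto simp: cut_column_def)
      ultimately show ?thesis using True c by blast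
    next
      case False
      then have "cut_column (S - {v, x, y}) c"
        using rc by (auto simp: cut_column_def)
      then show ?thesis using True c xy by blast
    qed
  next
    case False
    have "n \<noteq> 1"
    proof
      assume "n = 1"
      then have "snd u = c" if "u \<in> S" for u using that S c by force
      from this[of x] this[of y] xy show False
        using rc by (auto simp: path3_adj)
    qed
    \<comment> \<open>Only the last column has no column to its right; as \<open>n \<ge> 3\<close> is odd, two further columns
      exist on the side chosen by \<open>d\<close>.\<close>
    define d :: int where "d = (if c + 1 < a + int n then 1 else - 1)"
    have rng: "a \<le> c + d" "c + d < a + int n"
      using False c \<open>n \<noteq> 1\<close> by (auto simp: d_def)
    have "\<exists>s. (s, c) \<in> S \<and> (s, c + d) \<in> S"
      using conn[of c] conn[of "c + 1"] rng c by (auto simp: d_def split: if_splits)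
    then obtain s where s: "(s, c) \<in> S" "(s, c + d) \<in> S" by blast
    have "c + 1 < a + int n \<Longrightarrow> c + 2 < a + int n" using False by presburger
    moreover have "\<not> c + 1 < a + int n \<Longrightarrow> a < c - 1" using False c \<open>n \<noteq> 1\<close> by presburger
    ultimately have "\<exists>t. (t, c + d) \<in> S \<and> (t, c + 2 * d) \<in> S"
      using conn[of "c - 1"] conn[of "c + 2"] c by (auto simp: d_def algebra_simps)
    then obtain t where t: "(t, c + d) \<in> S" "(t, c + 2 * d) \<in> S" by blast
    have dd: "d = 1 \<or> d = - 1" by (simp add: d_def)
    have "\<exists>x y. path3 adj S v x y \<and> cut_column (S - {v, x, y}) (c + d)"
    proof (cases "(r, c + d) \<in> S")
      case True
      \<comment> \<open>If \<open>(r, c + d)\<close> is alone in its column, connectedness continues through it to the next one.\<close>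
      define y where "y = (if (\<not> r, c + d) \<in> S then (\<not> r, c + d) else (r, c + 2 * d))"
      have "path3 adj S v (r, c + d) y"
        using True t c(1) dd by (cases "t = r") (auto simp: path3_adj rc y_def)
      moreover have "cut_column (S - {v, (r, c + d), y}) (c + d)"
        by (auto simp: cut_column_def y_def)
      ultimately show ?thesis by blast
    next
      case r: False
      then have "s = (\<not> r)" using s by (cases s; cases r) auto
      then have "path3 adj S v (\<not> r, c) (\<not> r, c + d)"
        using s c(1) dd by (auto simp: path3_adj rc)
      moreover have "cut_column (S - {v, (\<not> r, c), (\<not> r, c + d)}) (c + d)"
        using r by (auto simp: cut_column_def)
      ultimately show ?thesis by blast
    qed
    moreover have "odd (c + d - a)" using False dd by auto
    ultimately show ?thesis using rng by blast
  qed
qed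

text \<open>A position without edges across some column boundary is split there, because
  \<open>\<lfloor>i/2\<rfloor> + \<lfloor>j/2\<rfloor> \<le> \<lfloor>(i+j)/2\<rfloor>\<close>;
  this case needs induction on the number of columns, as the set of vertices on one side may be
  empty. In all other positions,
  \<open>cutting_reply\<close> supplies the answer to each choice.\<close>

lemma Maximizer_columns_le:
  assumes "S \<subseteq> UNIV \<times> {a..<a + int n}"
  shows "val adj Maximizer S \<le> n div 2"
  using assms
proof (induction "card S + n" arbitrary: S a n rule: less_induct)
  case less
  have fin: "finite T" if "T \<subseteq> S" for T
    using that less.prems by (intro finite_subset[of T "UNIV \<times> {a..<a + int n}"]) auto
  have IH: "val adj Maximizer T \<le> n' div 2"
    if "T \<subseteq> S" "T \<subseteq> UNIV \<times> {a'..<a' + int n'}" "n' < n" for T a' n'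
    using that card_mono[OF fin[of S] that(1)] by (intro less.hyps[of T n' a']) auto
  show ?case
  proof (cases "\<exists>k. a < k \<and> k < a + int n \<and> (\<forall>r. (r, k - 1) \<in> S \<longrightarrow> (r, k) \<notin> S)")
    case True
    then obtain k where k: "a < k" "k < a + int n" "\<And>r. (r, k - 1) \<in> S \<Longrightarrow> (r, k) \<notin> S" by blast
    have "val adj Maximizer {u \<in> S. snd u < k} \<le> nat (k - a) div 2"
      using k less.prems by (intro IH[of _ a]) auto
    moreover have "val adj Maximizer {u \<in> S. k \<le> snd u} \<le> nat (a + int n - k) div 2"
      using k less.prems by (intro IH[of _ k]) auto
    moreover have "n = nat (k - a) + nat (a + int n - k)" using k by linarith
    moreover have "val adj Maximizer S
        = val adj Maximizer {u \<in> S. snd u < k} + val adj Maximizer {u \<in> S. k \<le> snd u}"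
      using k(3) fin[of S] by (intro val_split_columns) auto
    ultimately show ?thesis by linarith
  next
    case False
    show ?thesis
    proof (rule val_Maximizer_le)
      fix v assume v: "v \<in> ends adj S"
      obtain x y k where xy: "path3 adj S v x y" and k: "a \<le> k" "k < a + int n"
        and parity: "even n \<or> odd (k - a)" and cut: "cut_column (S - {v, x, y}) k"
        using cutting_reply[OF less.prems v] False by blast
      define T where "T = S - {v, x, y}"
      define i where "i = nat (k - a)"
      define j where "j = n - 1 - i"
      have n: "n = i + 1 + j" and ka: "k = a + int i" using k by (auto simp: i_def j_def)
      have T: "T \<subseteq> S" "card T < card S" using card_reply[OF fin[of S] xy] by (auto simp: T_def)
      have IHT: "val adj Maximizer T' \<le> n' div 2"
        if "T' \<subseteq> T" "T' \<subseteq> UNIV \<times> {a'..<a' + int n'}" "n' \<le> n" for T' a' n'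
        using that T card_mono[OF fin[of T] that(1)] by (intro less.hyps[of T' n' a']) auto
      have "val adj Maximizer {u \<in> T. snd u < k} \<le> i div 2"
        using T less.prems n ka by (intro IHT[of _ a]) auto
      moreover have "val adj Maximizer {u \<in> {u \<in> T. k \<le> snd u}. snd u < k + 1} \<le> 1 div 2"
        using n by (intro IHT[of _ k]) auto
      moreover have "val adj Maximizer {u \<in> {u \<in> T. k \<le> snd u}. k + 1 \<le> snd u} \<le> j div 2"
        using T less.prems n ka by (intro IHT[of _ "k + 1"]) auto
      moreover have "val adj Maximizer T = val adj Maximizer {u \<in> T. snd u < k}
          + val adj Maximizer {u \<in> T. k \<le> snd u}"
        using cut fin[OF T(1)] by (intro val_split_columns) (auto simp: T_def cut_column_def)
      moreover have "val adj Maximizer {u \<in> T. k \<le> snd u}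
        = val adj Maximizer {u \<in> {u \<in> T. k \<le> snd u}. snd u < k + 1}
          + val adj Maximizer {u \<in> {u \<in> T. k \<le> snd u}. k + 1 \<le> snd u}"
        using cut fin[OF T(1)] by (intro val_split_columns) (auto simp: T_def cut_column_def)
      ultimately have "val adj Maximizer T \<le> i div 2 + j div 2" by simp
      moreover have "even n \<or> odd i" using parity k by (auto simp: i_def even_nat_iff)
      then have "Suc (i div 2 + j div 2) \<le> n div 2" using n by presburger
      ultimately have "Suc (val adj Maximizer (S - {v, x, y})) \<le> n div 2"
        unfolding T_def by linarith
      then show "\<exists>x y. path3 adj S v x y \<and> Suc (val adj Maximizer (S - {v, x, y})) \<le> n div 2"
        using xy by blast
    qed (use fin symp_adj in auto)
  qed
qed

section \<open>Responding inside disjoint cells\<close>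

text \<open>If the chosen vertex lies in a cell, the responder stays in this cell. Otherwise, as soon as a
  path from \<open>v\<close> enters a cell with its middle vertex, its last vertex can be
  redirected to stay in that cell. A path that enters no cell with its middle vertex meets at most
  the cell of its last vertex.\<close>

lemma reply_meeting_one_cell:
  assumes disj: "pairwise disjnt \<C>"
    and cells: "\<And>C w. C \<in> \<C> \<Longrightarrow> w \<in> C \<Longrightarrow> w \<in> S \<and> (\<exists>w'\<in>C. w' \<noteq> w \<and> R w w')"
    and v: "v \<in> ends R S" "\<And>C. C \<in> \<C> \<Longrightarrow> v \<in> C \<Longrightarrow> v \<in> ends R C"
  shows "\<exists>a b D. path3 R S v a b \<and> (\<forall>C\<in>\<C>. C \<noteq> D \<longrightarrow> C \<subseteq> S - {v, a, b})"
proof -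
  have other: "C \<subseteq> S - X" if "X \<subseteq> D" "C \<in> \<C>" "D \<in> \<C>" "C \<noteq> D" for C D X
    using disj cells that by (fastforce simp: pairwise_def disjnt_def)
  have v': "C \<subseteq> S - X" if "C \<in> \<C>" "X \<inter> C = {}" for C X
    using cells that by blast
  consider (in_cell) D where "D \<in> \<C>" "v \<in> D" | (no_cell) "\<forall>C\<in>\<C>. v \<notin> C" by blast
  then show ?thesis
  proof cases
    case in_cell
    from v(2)[OF in_cell] obtain a b where "path3 R D v a b" unfolding ends_def by blast
    moreover from this have "{v, a, b} \<subseteq> D" by (auto simp: path3_def)
    ultimately have "path3 R S v a b" using cells in_cell by (auto simp: path3_def)
    then show ?thesis using other[OF \<open>{v, a, b} \<subseteq> D\<close>] in_cell by blast
  next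
    case no_cell
    from v(1) obtain x y where xy: "path3 R S v x y" by (auto simp: ends_def)
    consider (mid) D where "D \<in> \<C>" "x \<in> D" | (last) "\<forall>C\<in>\<C>. x \<notin> C" by blast
    then show ?thesis
    proof cases
      case mid
      then obtain w where w: "w \<in> D" "w \<noteq> x" "R x w" using cells by blast
      then have "path3 R S v x w"
        using xy cells no_cell mid by (auto simp: path3_def)
      moreover have "C \<subseteq> S - {v, x, w}" if "C \<in> \<C>" "C \<noteq> D" for C
        using other[of "{x, w}" D C] no_cell that mid w by auto
      ultimately show ?thesis by blast
    next
      case last
      obtain D where "\<forall>C\<in>\<C>. C \<noteq> D \<longrightarrow> y \<notin> C"
      proof (cases "\<exists>D\<in>\<C>. y \<in> D")
        case True
        then obtain D where "D \<in> \<C>" "y \<in> D" by blast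
        then have "\<forall>C\<in>\<C>. C \<noteq> D \<longrightarrow> y \<notin> C"
          using disj unfolding pairwise_def disjnt_iff by blast
        then show thesis by (rule that)
      qed (use that in blast)
      then have "C \<subseteq> S - {v, x, y}" if "C \<in> \<C>" "C \<noteq> D" for C
        using v'[of C "{v, x, y}"] that no_cell last by blast
      then show ?thesis using xy by blast
    qed
  qed
qed

text \<open>With the answers just described each round destroys at most one cell, and the game cannot end while a cell is intact.\<close>

lemma Minimizer_cells_ge:
  assumes "symp R" "finite S" "finite \<C>" "pairwise disjnt \<C>"
    and "\<And>C. C \<in> \<C> \<Longrightarrow> C \<noteq> {} \<and> C \<subseteq> S \<and> C \<subseteq> ends R C"
  shows "card \<C> \<le> val R Minimizer S"
  using assms(2-)
proof (induction "card S" arbitrary: S \<C> rule: less_induct)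
  case less
  have cells: "w \<in> S \<and> (\<exists>w'\<in>C. w' \<noteq> w \<and> R w w')" if "C \<in> \<C>" "w \<in> C" for C w
  proof -
    have "w \<in> ends R C" "C \<subseteq> S" using less.prems(4) that by blast+
    moreover from this obtain a b where "path3 R C w a b" unfolding ends_def by blast
    then have "a \<in> C" "a \<noteq> w" "R w a" by (auto simp: path3_def)
    ultimately show ?thesis using that(2) by blast
  qed
  have mono: "ends R C \<subseteq> ends R S" if "C \<subseteq> S" for C
    using that unfolding ends_def path3_def by blast
  show ?case
  proof (cases "\<C> = {}")
    case False
    show ?thesis
    proof (rule val_Minimizer_ge[OF assms(1) less.prems(1)])
      obtain C where "C \<in> \<C>" using False by blast
      from less.prems(4)[OF this] mono[of C] show "ends R S \<noteq> {}" by blast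
      fix v assume v: "v \<in> ends R S"
      have "v \<in> ends R C" if "C \<in> \<C>" "v \<in> C" for C
        using less.prems(4)[OF that(1)] that(2) by blast
      from reply_meeting_one_cell[OF less.prems(3) cells v this]
      obtain a b D where ab: "path3 R S v a b" "\<forall>C\<in>\<C>. C \<noteq> D \<longrightarrow> C \<subseteq> S - {v, a, b}"
        by blast
      have "card (\<C> - {D}) \<le> val R Minimizer (S - {v, a, b})"
      proof (rule less.hyps)
        show "pairwise disjnt (\<C> - {D})"
          using less.prems(3) by (rule pairwise_subset) blast
        fix C assume "C \<in> \<C> - {D}"
        then show "C \<noteq> {} \<and> C \<subseteq> S - {v, a, b} \<and> C \<subseteq> ends R C"
          using ab(2) less.prems(4)[of C] by blast
      qed (use card_reply[OF less.prems(1) ab(1)] less.prems(1,2) in simp_all)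
      moreover have "card \<C> \<le> Suc (card (\<C> - {D}))"
        using less.prems(2) by (cases "D \<in> \<C>") (simp_all add: card_Diff_singleton)
      ultimately have "card \<C> \<le> Suc (val R Minimizer (S - {v, a, b}))" by linarith
      then show "\<exists>a b. path3 R S v a b \<and> card \<C> \<le> Suc (val R Minimizer (S - {v, a, b}))"
        using ab(1) by blast
    qed
  qed simp
qed

section \<open>Blocks and trominoes in the ladder\<close>

definition block :: "int \<Rightarrow> (bool \<times> int) set" where
  "block b = UNIV \<times> {b, b + 1}"

lemma mem_block: "(s, j) \<in> block b \<longleftrightarrow> j = b \<or> j = b + 1"
  by (auto simp: block_def)

lemma block_subset_ends: "block b \<subseteq> ends adj (block b)"
proof
  fix v assume "v \<in> block b"
  then obtain r where "v = (r, b) \<or> v = (r, b + 1)" by (auto simp: block_def)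
  then have "path3 adj (block b) v (\<not> r, snd v) (\<not> r, if snd v = b then b + 1 else b)"
    by (auto simp: path3_adj block_def)
  then show "v \<in> ends adj (block b)" by (rule endsI)
qed

lemma disjoint_blocks:
  assumes "\<And>b. b \<in> B \<Longrightarrow> b + 1 \<notin> B"
  shows "pairwise disjnt (block ` B)"
proof -
  have "disjnt (block b) (block b')" if "b \<in> B" "b' \<in> B" "b \<noteq> b'" for b b'
    using that assms[of b] assms[of b'] by (auto simp: disjnt_def block_def)
  then show ?thesis by (auto simp: pairwise_def)
qed

lemma inj_block: "inj_on block B"
proof (rule inj_onI)
  fix b b' assume "block b = block b'"
  then have "(True, b) \<in> block b'" "(True, b') \<in> block b"
    by (auto simp: block_def)
  then show "b = b'" by (auto simp: block_def)
qed

lemma Minimizer_blocks_ge: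
  assumes "finite S" "finite B" "\<And>b. b \<in> B \<Longrightarrow> b + 1 \<notin> B" "\<And>b. b \<in> B \<Longrightarrow> block b \<subseteq> S"
  shows "card B \<le> val adj Minimizer S"
proof -
  have "card (block ` B) \<le> val adj Minimizer S"
  proof (rule Minimizer_cells_ge[OF symp_adj assms(1) _ disjoint_blocks[OF assms(3)]])
    fix C assume "C \<in> block ` B"
    then obtain b where b: "b \<in> B" "C = block b" by blast
    have "block b \<noteq> {}" by (simp add: block_def)
    then show "C \<noteq> {} \<and> C \<subseteq> S \<and> C \<subseteq> ends adj C"
      using assms(4) block_subset_ends b by simp
  qed (use assms(2) in auto)
  then show ?thesis by (simp add: card_image inj_block)
qed

text \<open>The L consists of a pendant vertex \<open>(r, c)\<close> and column \<open>c + 1\<close>; it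
  counts as an additional cell although its corner \<open>(r, c + 1)\<close> starts no path inside
  it. When the corner is chosen and the next two columns form an intact block, the path through
  the rest of column \<open>c + 1\<close> into the block leaves a new L, two columns further on.
  If there is no such block, every available path from the corner avoids all blocks: the pendant
  vertex has no other neighbour, and because of the parity condition no block starts at \<open>c +
  3\<close>, the farthest column that can be reached.\<close>

lemma Minimizer_tromino_ge:
  assumes "finite S" "finite B" "\<And>b. b \<in> B \<Longrightarrow> b + 1 \<notin> B" "\<And>b. b \<in> B \<Longrightarrow> block b \<subseteq> S"
    and "(r, c) \<in> S" "(r, c + 1) \<in> S" "(\<not> r, c + 1) \<in> S" "(\<not> r, c) \<notin> S" "(r, c - 1) \<notin> S"
    and "\<And>b. b \<in> B \<Longrightarrow> c < b \<Longrightarrow> even (b - c)"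
  shows "Suc (card B) \<le> val adj Minimizer S"
  using assms
proof (induction "card S" arbitrary: S B r c rule: less_induct)
  case less
  note fin = less.prems(1,2) and apart = less.prems(3) and blocks = less.prems(4)
    and L = less.prems(5-9) and parity = less.prems(10)
  define L where "L = {(r, c), (r, c + 1), (\<not> r, c + 1)}"
  have col: "b \<noteq> c \<and> b + 1 \<noteq> c \<and> b \<noteq> c + 1" if "b \<in> B" for b
    using blocks[OF that] parity[OF that] L(4) by (auto simp: block_def)
  have disj: "pairwise disjnt (insert L (block ` B))"
  proof -
    have "disjnt L (block b)" if "b \<in> B" for b
      using col[OF that] by (auto simp: disjnt_def L_def block_def)
    then show ?thesis
      using disjoint_blocks[OF apart] by (auto simp: pairwise_insert disjnt_sym)
  qed
  show ?case
  proof (rule val_Minimizer_ge[OF symp_adj fin(1)])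
    have "path3 adj S (r, c) (r, c + 1) (\<not> r, c + 1)"
      using L by (auto simp: path3_adj)
    from endsI[OF this] show "ends adj S \<noteq> {}" by blast
    fix v assume v: "v \<in> ends adj S"
    show "\<exists>x y. path3 adj S v x y \<and> Suc (card B) \<le> Suc (val adj Minimizer (S - {v, x, y}))"
    proof (cases "v = (r, c + 1)")
      case centre: True
      show ?thesis
      proof (cases "c + 2 \<in> B")
        case True
        let ?x = "(\<not> r, c + 1)" and ?y = "(\<not> r, c + 2)"
        have new: "(s, c + 2) \<in> S" "(s, 3 + c) \<in> S" for s
          using blocks[OF True] by (auto simp: block_def)
        have p3: "path3 adj S v ?x ?y"
          using L new centre by (auto simp: path3_adj)
        have "Suc (card (B - {c + 2})) \<le> val adj Minimizer (S - {v, ?x, ?y})"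
        proof (rule less.hyps[where r = r and c = "c + 2"])
          show "block b \<subseteq> S - {v, ?x, ?y}" if "b \<in> B - {c + 2}" for b
            using blocks[of b] col[of b] that centre by (auto simp: block_def)
          show "even (b - (c + 2))" if "b \<in> B - {c + 2}" "c + 2 < b" for b
            using parity[of b] that by simp
        qed (use card_reply[OF fin(1) p3] fin apart new centre in auto)
        moreover have "card (B - {c + 2}) = card B - 1" "0 < card B"
          using True fin by (auto simp: card_gt_0_iff)
        ultimately show ?thesis using p3 by (intro exI[of _ ?x] exI[of _ ?y]) auto
      next
        case False
        from v obtain x y where xy: "path3 adj S v x y" by (auto simp: ends_def)
        have range: "snd x \<in> {c..c + 2}" "snd y \<in> {c..c + 3}"
          using xy L centre by (auto simp: path3_adj)
        have "block b \<subseteq> S - {v, x, y}" if "b \<in> B" for b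
        proof -
          \<comment> \<open>A block starting at \<open>c + 3\<close> would have the wrong parity.\<close>
          have "b \<noteq> c + 2" "b \<noteq> c + 3" using False that parity[OF that] by auto
          with col[OF that] have "b \<notin> {c - 1..c + 3}" by auto
          then have "x \<notin> block b" "y \<notin> block b" "v \<notin> block b"
            using range centre by (auto simp: block_def mem_Times_iff)
          then show ?thesis using blocks[OF that] by blast
        qed
        then have "card B \<le> val adj Minimizer (S - {v, x, y})"
          using fin apart by (intro Minimizer_blocks_ge) auto
        then show ?thesis using xy Suc_le_mono by blast
      qed
    next
      case False
      have cells: "w \<in> S \<and> (\<exists>w'\<in>C. w' \<noteq> w \<and> adj w w')"
        if C: "C \<in> insert L (block ` B)" "w \<in> C" for C w
      proof (cases "C = L")
        case True
        then show ?thesis using that L by (auto simp: L_def adj_def)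
      next
        case False
        then obtain b where b: "b \<in> B" "C = block b" using C(1) by blast
        then have "(\<not> fst w, snd w) \<in> C" "adj w (\<not> fst w, snd w)" "(\<not> fst w, snd w) \<noteq> w"
          using that(2) by (auto simp: block_def adj_def prod_eq_iff)
        then show ?thesis using blocks[OF b(1)] b(2) that(2) by blast
      qed
      have in_cell: "v \<in> ends adj C" if C: "C \<in> insert L (block ` B)" "v \<in> C" for C
      proof (cases "C = L")
        case True
        have "path3 adj L (r, c) (r, c + 1) (\<not> r, c + 1)" "path3 adj L (\<not> r, c + 1) (r, c + 1) (r, c)"
          by (auto simp: path3_adj L_def)
        then show ?thesis using that(2) True False by (auto simp: L_def ends_def)
      next
        case False
        then obtain b where "C = block b" using C(1) by blast
        then show ?thesis using C(2) block_subset_ends[of b] by blast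
      qed
      from reply_meeting_one_cell[OF disj cells v in_cell]
      obtain x y D where xy: "path3 adj S v x y"
        and D: "\<forall>C\<in>insert L (block ` B). C \<noteq> D \<longrightarrow> C \<subseteq> S - {v, x, y}"
        by blast
      have "card B \<le> val adj Minimizer (S - {v, x, y})"
      proof (cases "D = L")
        case True
        have "block b \<subseteq> S - {v, x, y}" if "b \<in> B" for b
        proof -
          have "(r, c) \<notin> block b" "(r, c) \<in> L"
            using col[OF that] by (auto simp: L_def block_def)
          then show ?thesis using D True that by blast
        qed
        then show ?thesis
          using fin apart by (intro Minimizer_blocks_ge) auto
      next
        case False
        let ?B = "{b \<in> B. block b \<noteq> D}"
        have L_left: "L \<subseteq> S - {v, x, y}" using D False by blast
        have "Suc (card ?B) \<le> val adj Minimizer (S - {v, x, y})"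
        proof (rule less.hyps[where r = r and c = c])
          show "block b \<subseteq> S - {v, x, y}" if "b \<in> ?B" for b
            using D that by blast
          show "(r, c) \<in> S - {v, x, y}" "(r, c + 1) \<in> S - {v, x, y}" "(\<not> r, c + 1) \<in> S - {v, x, y}"
            using L_left by (simp_all add: L_def)
        qed (use card_reply[OF fin(1) xy] fin apart L parity in auto)
        moreover have "card B \<le> Suc (card ?B)"
        proof (cases "D \<in> block ` B")
          case True
          then obtain b where "b \<in> B" "D = block b" by blast
          then have "?B = B - {b}" using inj_onD[OF inj_block[of B]] by blast
          then show ?thesis using \<open>b \<in> B\<close> fin by (simp add: card_Diff_singleton)
        next
          case False
          then have "?B = B" by blast
          then show ?thesis by simp
        qed
        ultimately show ?thesis by linarith
      qed
      then show ?thesis using xy Suc_le_mono by blast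
    qed
  qed
qed

text \<open>The \<open>n\<close> blocks that remain in \<open>2 n + 3\<close> columns next to an L occupying
  columns \<open>2 l + 1\<close> and \<open>2 l + 2\<close>, with column \<open>2 l\<close> empty:
  the first \<open>l\<close> blocks lie to the left, the others, shifted by three, to the right.\<close>

definition split_blocks :: "nat \<Rightarrow> nat \<Rightarrow> int set" where
  "split_blocks l n = (\<lambda>i. if i < l then 2 * int i else 2 * int i + 3) ` {..<n}"

lemma split_blocks:
  "finite (split_blocks l n)" "card (split_blocks l n) = n"
  "b \<in> split_blocks l n \<Longrightarrow> b + 1 \<notin> split_blocks l n"
  "b \<in> split_blocks l n \<Longrightarrow>
    0 \<le> b \<and> b + 1 < 2 * int n + 3 \<and> (even b \<and> b + 2 \<le> 2 * int l \<or> odd b \<and> 2 * int l + 3 \<le> b)"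
proof -
  show "finite (split_blocks l n)" by (simp add: split_blocks_def)
  have "inj_on (\<lambda>i. if i < l then 2 * int i else 2 * int i + 3) {..<n}"
    by (auto simp: inj_on_def split: if_splits)
  then show "card (split_blocks l n) = n"
    unfolding split_blocks_def by (simp only: card_image card_lessThan)
  show "b + 1 \<notin> split_blocks l n" if "b \<in> split_blocks l n"
    using that by (auto simp: split_blocks_def split: if_splits) presburger+
  show "0 \<le> b \<and> b + 1 < 2 * int n + 3 \<and> (even b \<and> b + 2 \<le> 2 * int l \<or> odd b \<and> 2 * int l + 3 \<le> b)"
    if "b \<in> split_blocks l n"
    using that by (auto simp: split_blocks_def split: if_splits)
qed

text \<open>First answers to a choice in column \<open>2 l\<close> and in column \<open>2 l + 1\<close>. Both
  leave one vertex of \<open>2 l + 1\<close>, which becomes the pendant vertex of the L.\<close>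

lemma Minimizer_after_even_column:
  assumes "l \<le> n"
  shows "Suc n \<le> val adj Minimizer (UNIV \<times> {0..<2 * int n + 3} -
    {(r, 2 * int l), (\<not> r, 2 * int l), (\<not> r, 2 * int l + 1)})"
proof -
  have "Suc (card (split_blocks l n)) \<le> val adj Minimizer (UNIV \<times> {0..<2 * int n + 3} -
    {(r, 2 * int l), (\<not> r, 2 * int l), (\<not> r, 2 * int l + 1)})"
  proof (rule Minimizer_tromino_ge[where r = r and c = "2 * int l + 1"])
    fix b assume b: "b \<in> split_blocks l n"
    note * = split_blocks(4)[OF b]
    show "b + 1 \<notin> split_blocks l n" using b by (rule split_blocks)
    show "block b \<subseteq> UNIV \<times> {0..<2 * int n + 3} -
        {(r, 2 * int l), (\<not> r, 2 * int l), (\<not> r, 2 * int l + 1)}"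
      using * by (auto simp: mem_block)
    show "even (b - (2 * int l + 1))" if "2 * int l + 1 < b"
      using * that by auto
  qed (use assms in \<open>auto simp: split_blocks(1)\<close>)
  then show ?thesis by (simp add: split_blocks)
qed

lemma Minimizer_after_odd_column:
  assumes "l \<le> n"
  shows "Suc n \<le> val adj Minimizer (UNIV \<times> {0..<2 * int n + 3} -
    {(r, 2 * int l + 1), (r, 2 * int l), (\<not> r, 2 * int l)})"
proof -
  have "Suc (card (split_blocks l n)) \<le> val adj Minimizer (UNIV \<times> {0..<2 * int n + 3} -
    {(r, 2 * int l + 1), (r, 2 * int l), (\<not> r, 2 * int l)})"
  proof (rule Minimizer_tromino_ge[where r = "\<not> r" and c = "2 * int l + 1"])
    fix b assume b: "b \<in> split_blocks l n"
    note * = split_blocks(4)[OF b]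
    show "b + 1 \<notin> split_blocks l n" using b by (rule split_blocks)
    show "block b \<subseteq> UNIV \<times> {0..<2 * int n + 3} -
        {(r, 2 * int l + 1), (r, 2 * int l), (\<not> r, 2 * int l)}"
      using * by (auto simp: mem_block)
    show "even (b - (2 * int l + 1))" if "2 * int l + 1 < b"
      using * that by auto
  qed (use assms in \<open>auto simp: split_blocks(1)\<close>)
  then show ?thesis by (simp add: split_blocks)
qed

lemma val_reflect:
  assumes "finite S"
  shows "val adj P ((\<lambda>(s, j). (s, k - j)) ` S) = val adj P S"
proof (rule val_image)
  fix u w :: "bool \<times> int"
  have "\<bar>(k - snd u) - (k - snd w)\<bar> = \<bar>snd u - snd w\<bar>" by linarith
  then show "adj (case u of (s, j) \<Rightarrow> (s, k - j)) (case w of (s, j) \<Rightarrow> (s, k - j)) \<longleftrightarrow> adj u w"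
    by (simp add: adj_def case_prod_unfold)
qed (use assms in \<open>auto simp: symp_adj inj_on_def\<close>)

text \<open>In the last column there is no room for an L to the right, so the answer is the mirror image of
  the one in column \<open>0\<close>.\<close>

lemma Minimizer_after_last_column:
  "Suc n \<le> val adj Minimizer (UNIV \<times> {0..<2 * int n + 3} -
    {(r, 2 * int n + 2), (\<not> r, 2 * int n + 2), (\<not> r, 2 * int n + 1)})"
proof -
  let ?f = "\<lambda>(s :: bool, j). (s, 2 * int n + 2 - j)"
  let ?S = "UNIV \<times> {0..<2 * int n + 3} - {(r, 0), (\<not> r, 0), (\<not> r, 1)}"
  have inv: "?f (?f x) = x" for x by (cases x) simp
  have "UNIV \<times> {0..<2 * int n + 3} - {(r, 2 * int n + 2), (\<not> r, 2 * int n + 2), (\<not> r, 2 * int n + 1)}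
      = ?f ` ?S"
  proof (intro equalityI subsetI)
    fix x assume "x \<in> UNIV \<times> {0..<2 * int n + 3} -
      {(r, 2 * int n + 2), (\<not> r, 2 * int n + 2), (\<not> r, 2 * int n + 1)}"
    then have "?f x \<in> ?S" by auto
    then show "x \<in> ?f ` ?S" by (rule image_eqI[where f = ?f, OF inv[of x, symmetric]])
  qed auto
  moreover have "val adj Minimizer (?f ` ?S) = val adj Minimizer ?S"
    by (rule val_reflect) simp
  moreover have "Suc n \<le> val adj Minimizer ?S"
    using Minimizer_after_even_column[of 0 n r] by simp
  ultimately show ?thesis by (simp only:)
qed

lemma Minimizer_odd_strip_ge:
  "n + 2 \<le> val adj Minimizer (UNIV \<times> {0..<2 * int n + 3})" (is "_ \<le> val adj _ ?S")
proof (rule val_Minimizer_ge)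
  have "path3 adj ?S (True, 0) (True, 1) (True, 2)" by (simp add: path3_adj)
  from endsI[OF this] show "ends adj ?S \<noteq> {}" by blast
  fix v assume "v \<in> ends adj ?S"
  then have "v \<in> ?S" by (rule subsetD[OF ends_subset])
  then obtain r c where v: "v = (r, c)" "0 \<le> c" "c < 2 * int n + 3" by auto
  obtain k where k: "c = int k" using v(2) by (rule nonneg_int_cases)
  define l where "l = k div 2"
  have "k = 2 * l \<or> k = 2 * l + 1" unfolding l_def by presburger
  then have "c = 2 * int l \<or> c = 2 * int l + 1" using k by linarith
  then consider (even) "c = 2 * int l" "l \<le> n" | (odd) "c = 2 * int l + 1" "l \<le> n"
    | (last) "c = 2 * int n + 2"
    using v(3) by fastforce
  then show "\<exists>a b. path3 adj ?S v a b \<and> n + 2 \<le> Suc (val adj Minimizer (?S - {v, a, b}))"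
  proof cases
    case even
    then show ?thesis using v Minimizer_after_even_column[OF even(2), of r]
      by (intro exI[of _ "(\<not> r, c)"] exI[of _ "(\<not> r, c + 1)"]) (simp add: path3_adj)
  next
    case odd
    then show ?thesis using v Minimizer_after_odd_column[OF odd(2), of r]
      by (intro exI[of _ "(r, c - 1)"] exI[of _ "(\<not> r, c - 1)"]) (simp add: path3_adj)
  next
    case last
    let ?a = "(\<not> r, 2 * int n + 2)" and ?b = "(\<not> r, 2 * int n + 1)"
    have "path3 adj ?S v ?a ?b" using v last by (auto simp: path3_adj)
    moreover have "v = (r, 2 * int n + 2)" using v last by simp
    ultimately show ?thesis using Minimizer_after_last_column[of n r]
      by (intro exI[of _ ?a] exI[of _ ?b]) simp
  qed
qed (simp_all add: symp_adj)

lemma Minimizer_strip_ge: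
  assumes "2 \<le> m"
  shows "Suc m div 2 \<le> val adj Minimizer (UNIV \<times> {0..<int m})"
proof (cases "even m")
  case True
  then obtain k where m: "m = 2 * k" by blast
  have "card ((\<lambda>i. 2 * int i) ` {..<k}) \<le> val adj Minimizer (UNIV \<times> {0..<int m})"
  proof (rule Minimizer_blocks_ge)
    fix b assume "b \<in> (\<lambda>i. 2 * int i) ` {..<k}"
    then obtain i where i: "b = 2 * int i" "i < k" by auto
    show "b + 1 \<notin> (\<lambda>i. 2 * int i) ` {..<k}" using i(1) by auto presburger
    show "block b \<subseteq> UNIV \<times> {0..<int m}" using i m by (auto simp: mem_block)
  qed simp_all
  moreover have "card ((\<lambda>i. 2 * int i) ` {..<k}) = k"
    by (simp add: card_image inj_on_def)
  ultimately show ?thesis using m by simp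
next
  case False
  define n where "n = (m - 3) div 2"
  have m: "m = 2 * n + 3" using assms False unfolding n_def by presburger
  show ?thesis using Minimizer_odd_strip_ge[of n] unfolding m by simp
qed

theorem lemma14:
  fixes m :: nat
  assumes "m \<ge> 1"
  shows "(m \<ge> 2 \<longrightarrow> int (stripe_value Minimizer (grid 2 m)) = \<lceil>real m / 2\<rceil>) \<and>
         int (stripe_value Maximizer (grid 2 m)) = \<lfloor>real m / 2\<rfloor>"
proof -
  have strip: "UNIV \<times> {0..<int m} = stair m m" by auto
  have "stripe_value Minimizer (grid 2 m) = Suc m div 2" if "2 \<le> m"
    using Minimizer_strip_ge[OF that] Minimizer_stair_le[of m]
    by (simp add: stripe_value_grid strip)
  moreover have "stripe_value Maximizer (grid 2 m) = m div 2"
    using Maximizer_columns_le[of "UNIV \<times> {0..<int m}" 0 m] Maximizer_stair_ge[of m]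
    by (simp add: stripe_value_grid strip)
  moreover have "\<lceil>real m / 2\<rceil> = int (Suc m div 2)"
    by (cases "even m") (auto elim!: evenE oddE simp: ceiling_eq_iff)
  moreover have "\<lfloor>real m / 2\<rfloor> = int (m div 2)"
    by (cases "even m") (auto elim!: evenE oddE simp: floor_eq_iff)
  ultimately show ?thesis by simp
qed

end
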